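(* Let $\lambda(p,q)$, for $p,q\in\mathbb{R}_+$, be the zero of $Q(\cdot,p,q)$ defined in the context. Then: (i) The assignment $\mathbb{R}_+^2\ni(p,q)\mapsto\lambda(p,q)\in\mathbb{R}_+$ defines a continuous function such that $\lambda(p,n)=\lambda^{(n)}(p)$ for every $(p,n)\in\mathbb{R}_+\times\mathbb{N}$. (ii) On the set $\{(p,q)\in\mathbb{R}_+^2: p\cdot q\neq 1\}$ the function $\lambda(p,q)$ is of class $C^\infty$, and the restriction of $\lambda(p,q)$ to (the part in $\mathbb{R}_+^2$ of) any line $\ell$ with directional angle $\alpha$, $0\le\alpha\le\pi/2$, is strictly increasing (in the direction $(\cos\alpha,\sin\alpha)$). (iii) For any $p>0$ and $q\ge 1$, $p\le\lambda(p,q)$, and for any $p\in\mathbb{R}_+$, $\lim_{q\to\infty}\lambda(p,q)=p+1$. (iv) For any $p_0\in\mathbb{R}_+$, $\lim_{(p,q)\to(p_0,0)}\lambda(p,q)=0$, and for any $q_0\in\mathbb{R}_+$, $\lim_{(p,q)\to(0,q_0)}\lambda(p,q)=0$ (limits taken over $(p,q)\in\mathbb{R}_+^2$); i.e., $\lambda$ can be extended from the open domain $\mathbb{R}_+^2$ to a continuous function on the closed domain $\overline{\mathbb{R}}_+^2$.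
   Context: $\mathbb{R}_+=(0,\infty)$, $\overline{\mathbb{R}}_+=[0,\infty)$, $\mathbb{N}=\{1,2,3,\dots\}$. For $\lambda,p,q\in\mathbb{R}_+$ let $Q(\lambda,p,q)=\lambda^{q+1}-(p+1)\lambda^q+p$. For $p,q\in\mathbb{R}_+$ with $p\cdot q\ne1$, $\lambda(p,q)$ is the unique positive zero different from $1$ of the function $\lambda\mapsto Q(\lambda,p,q)$; if $p\cdot q=1$, $\lambda(p,q)=1$, which is then the unique positive zero. For $p\in\mathbb{R}_+$ and $n\in\mathbb{N}$, $\lambda^{(n)}(p)$ denotes the dominant root of the polynomial $P^{(n)}_p(\lambda)=\lambda^n-p(\lambda^{n-1}+\cdots+\lambda+1)$, i.e. its unique positive root, which is simple and has modulus strictly larger than that of every other root. *)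

theory Defs
  imports "HOL-Analysis.Analysis" "HOL-Computational_Algebra.Computational_Algebra"
begin

definition Q :: "real \<Rightarrow> real \<Rightarrow> real \<Rightarrow> real" where
  "Q x p q = x powr (q + 1) - (p + 1) * x powr q + p"

text \<open>The zero \<open>\<lambda>(p,q)\<close>; only meaningful for positive \<open>p\<close> and \<open>q\<close>. The point \<open>x = 1\<close> is always
  a zero of \<open>Q\<close>, and for \<open>p * q = 1\<close> it is the only positive one.\<close>

definition lam :: "real \<Rightarrow> real \<Rightarrow> real" where
  "lam p q = (if p * q = 1 then 1 else (THE x. x > 0 \<and> x \<noteq> 1 \<and> Q x p q = 0))"

definition P :: "nat \<Rightarrow> real \<Rightarrow> real poly" where
  "P n p = monom 1 n - smult p (\<Sum>k<n. monom 1 k)"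

definition is_dominant_root :: "complex poly \<Rightarrow> complex \<Rightarrow> bool" where
  "is_dominant_root f z \<longleftrightarrow> poly f z = 0 \<and> order z f = 1 \<and>
     (\<forall>w. poly f w = 0 \<and> w \<noteq> z \<longrightarrow> cmod w < cmod z)"

text \<open>Dominance refers to all complex roots of the real polynomial \<open>P n p\<close>.\<close>

definition lam_n :: "nat \<Rightarrow> real \<Rightarrow> real" where
  "lam_n n p = (THE r. r > 0 \<and> poly (P n p) r = 0 \<and>
     (\<forall>s>0. poly (P n p) s = 0 \<longrightarrow> s = r) \<and>
     is_dominant_root (map_poly complex_of_real (P n p)) (complex_of_real r))"

text \<open>\<open>C_on k S f\<close>: \<open>f\<close> is of class \<open>C\<^sup>k\<close> on the open set \<open>S\<close>. The recursion runs over all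
  directional derivatives (in particular all partial derivatives), so that the codomain stays the
  same at every level.\<close>

fun C_on :: "nat \<Rightarrow> 'a::euclidean_space set \<Rightarrow> ('a \<Rightarrow> 'b::real_normed_vector) \<Rightarrow> bool" where
  "C_on 0 S f \<longleftrightarrow> continuous_on S f"
| "C_on (Suc k) S f \<longleftrightarrow> (\<forall>x\<in>S. f differentiable (at x)) \<and>
     (\<forall>v. C_on k S (\<lambda>x. frechet_derivative f (at x) v))"

definition smooth_on :: "'a::euclidean_space set \<Rightarrow> ('a \<Rightarrow> 'b::real_normed_vector) \<Rightarrow> bool" where
  "smooth_on S f \<longleftrightarrow> open S \<and> (\<forall>k. C_on k S f)"

end

theory Submission
  imports Defs
begin

text \<open>
  For \<open>x \<noteq> 1\<close> the equation \<open>Q(x,p,q) = 0\<close> can be solved for \<open>p\<close>: it says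
  \<open>p = \<Phi>(x,q) = (1 - x) / (x powr (- q) - 1)\<close>. With \<open>\<Phi>(1,q) = 1/q\<close> this function is strictly
  increasing in \<open>x\<close> and strictly decreasing in \<open>q\<close>, and \<open>\<lambda>(\<cdot>,q)\<close> is the inverse of \<open>\<Phi>(\<cdot>,q)\<close>.
  Hence \<open>x < \<lambda>(p,q)\<close> iff \<open>\<Phi>(x,q) < p\<close>, and continuity, monotonicity and all limits are read off
  from elementary properties of \<open>\<Phi>\<close>. Since \<open>\<partial>\<Phi>/\<partial>x > 0\<close> away from \<open>x = 1\<close>, \<open>\<lambda>\<close> is differentiable where
  \<open>p q \<noteq> 1\<close>, with partial derivatives that are elementary expressions in \<open>p\<close>, \<open>q\<close> and \<open>\<lambda>\<close>; the class
  of such expressions is closed under differentiation, so \<open>\<lambda>\<close> is smooth. For \<open>q = n\<close> one has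
  \<open>\<Phi>(s,n) = s ^ n / (\<Sum>k<n. s ^ k)\<close>, whence the comparison with the roots of \<open>P n p\<close>.
\<close>

lemma eventually_less_tendsto:
  fixes a b :: real
  assumes "(f \<longlongrightarrow> a) F" "(g \<longlongrightarrow> b) F" "a < b"
  shows "\<forall>\<^sub>F x in F. f x < g x"
  using order_tendstoD(1)[OF tendsto_diff[OF assms(2,1)], of 0] assms(3) by simp

text \<open>The value at \<open>x = 1\<close> is the limit, which makes \<open>Phi\<close> strictly increasing across that point.\<close>

definition Phi :: "real \<Rightarrow> real \<Rightarrow> real" where
  "Phi x q = (if x = 1 then 1 / q else (1 - x) / (exp (- (q * ln x)) - 1))"

section \<open>Monotonicity of \<open>Phi\<close> in its first argument\<close>

lemma exp_gt_add_one: "1 + y < exp y" if "y \<noteq> 0" for y :: real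
proof -
  have "y \<noteq> exp y - 1"
    using ln_eq_minus_one[of "exp y"] that by auto
  then show ?thesis
    using exp_ge_add_one_self[of y] by linarith
qed

lemma ln_less_minus_one: "ln x < x - 1" if "x > 0" "x \<noteq> 1" for x :: real
  using ln_eq_minus_one[of x] ln_le_minus_one[of x] that by force

lemma minus_one_less_mult_ln: "1 - 1 / x < ln x" if "x > 0" "x \<noteq> 1" for x :: real
  using ln_less_minus_one[of "1 / x"] that by (simp add: ln_div)

lemma exp_mult_ln_neq_one: "exp (- (q * ln x)) \<noteq> 1" if "x > 0" "x \<noteq> 1" "q > 0" for x q :: real
  using that by simp

lemma exp_mult_ln_gt_one: "exp (- (q * ln x)) > 1" if "0 < x" "x < 1" "q > 0" for x q :: real
  using that by (simp add: mult_pos_neg)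

lemma exp_mult_ln_less_one: "exp (- (q * ln x)) < 1" if "x > 1" "q > 0" for x q :: real
  using that by simp

text \<open>This is the numerator of the \<open>x\<close>-derivative of the quotient defining
  \<open>Phi\<close>. After \<open>exp (- (q * ln x))\<close> is factored out, the rest is
  \<open>exp (q * ln x) - 1 - q * (1 - 1 / x)\<close>, and the tangent bounds
  \<open>1 - 1 / x < ln x\<close> and \<open>1 + y < exp y\<close> apply.\<close>

lemma Phi_deriv_numerator_pos:
  fixes x q :: real
  assumes "x > 0" "x \<noteq> 1" "q > 0"
  shows "1 - exp (- (q * ln x)) + (1 - x) * q * exp (- (q * ln x)) / x > 0"
proof -
  have "q * (1 - 1 / x) < q * ln x"
    using minus_one_less_mult_ln[of x] assms by simp
  also have "q * ln x < exp (q * ln x) - 1"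
    using exp_gt_add_one[of "q * ln x"] assms by simp
  finally have "0 < exp (- (q * ln x)) * (exp (q * ln x) - 1 - q * (1 - 1 / x))"
    by simp
  also have "\<dots> = 1 - exp (- (q * ln x)) + (1 - x) * q * exp (- (q * ln x)) / x"
    using assms by (simp add: field_simps exp_minus)
  finally show ?thesis .
qed

lemma DERIV_Phi_formula:
  fixes x q :: real
  assumes "x > 0" "x \<noteq> 1" "q > 0"
  shows "((\<lambda>x. (1 - x) / (exp (- (q * ln x)) - 1)) has_real_derivative
    (1 - exp (- (q * ln x)) + (1 - x) * q * exp (- (q * ln x)) / x)
      / (exp (- (q * ln x)) - 1)\<^sup>2) (at x)"
  using assms exp_mult_ln_neq_one[OF assms]
  by (auto intro!: derivative_eq_intros simp: power2_eq_square field_simps)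

text \<open>The last hypothesis keeps 1 out of the interval from \<open>x\<close> to
  \<open>y\<close>, so that the quotient formula and its positive derivative are valid
  throughout.\<close>

lemma Phi_formula_strict_mono:
  fixes x y q :: real
  assumes "0 < x" "x < y" "q > 0" "y < 1 \<or> 1 < x"
  shows "Phi x q < Phi y q"
proof -
  have "(1 - x) / (exp (- (q * ln x)) - 1) < (1 - y) / (exp (- (q * ln y)) - 1)"
  proof (rule DERIV_pos_imp_increasing[OF \<open>x < y\<close>])
    fix z assume "x \<le> z" "z \<le> y"
    then have z: "z > 0" "z \<noteq> 1" using assms by auto
    show "\<exists>d. ((\<lambda>x. (1 - x) / (exp (- (q * ln x)) - 1)) has_real_derivative d) (at z) \<and> 0 < d"
      using DERIV_Phi_formula[OF z \<open>q > 0\<close>] Phi_deriv_numerator_pos[OF z \<open>q > 0\<close>]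
        exp_mult_ln_neq_one[OF z \<open>q > 0\<close>]
      by (intro exI conjI) (assumption, simp)
  qed
  then show ?thesis using assms by (auto simp: Phi_def)
qed

text \<open>With its counterpart for \<open>x > 1\<close> this joins the two branches at the value
  \<open>1 / q\<close>. Both chain the strict tangent bounds of \<open>ln\<close> and
  \<open>exp\<close> to compare numerator and denominator.\<close>

lemma Phi_less_one: "Phi x q < 1 / q" if "0 < x" "x < 1" "q > 0"
proof -
  have "q * (1 - x) < q * - ln x"
    using ln_less_minus_one[of x] that by (intro mult_strict_left_mono) auto
  also have "\<dots> < exp (- (q * ln x)) - 1"
    using exp_gt_add_one[of "- (q * ln x)"] that by auto
  finally show ?thesis
    using that exp_mult_ln_gt_one[OF that] by (simp add: Phi_def field_simps)
qed

lemma Phi_greater_one: "1 / q < Phi x q" if "1 < x" "q > 0"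
proof -
  have "1 - exp (- (q * ln x)) < q * ln x"
    using exp_gt_add_one[of "- (q * ln x)"] that by simp
  also have "\<dots> < q * (x - 1)"
    using ln_less_minus_one[of x] that by simp
  finally show ?thesis
    using that exp_mult_ln_less_one[OF that] by (simp add: Phi_def field_simps)
qed

lemma Phi_strict_mono: "Phi x q < Phi y q" if "0 < x" "x < y" "q > 0"
proof -
  consider "y < 1 \<or> 1 < x" | "x < 1" "1 < y" | "x = 1" | "y = 1" by linarith
  then show ?thesis
  proof cases
    case 1 then show ?thesis using that Phi_formula_strict_mono by blast
  next
    case 2 then show ?thesis
      using Phi_less_one[of x q] Phi_greater_one[of y q] that by simp
  next
    case 3 then show ?thesis using Phi_greater_one[of y q] that by (simp add: Phi_def)
  next
    case 4 then show ?thesis using Phi_less_one[of x q] that by (simp add: Phi_def)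
  qed
qed

section \<open>Zeros of \<open>Q\<close>, and \<open>lam\<close> as the inverse of
  \<open>Phi\<close>\<close>

lemma Q_eq_0_iff:
  assumes "x > 0" "x \<noteq> 1" "q > 0"
  shows "Q x p q = 0 \<longleftrightarrow> Phi x q = p"
proof -
  let ?u = "exp (- (q * ln x))"
  have u: "?u \<noteq> 1" using exp_mult_ln_neq_one[OF assms] .
  have e: "x powr q * ?u = 1" "x powr q > 0"
    using assms by (simp_all add: powr_def exp_minus)
  \<comment> \<open>Since \<open>x powr q\<close> is the reciprocal of \<open>?u\<close>, it can be
    factored out of all three terms, which leaves an equation linear in \<open>p\<close>.\<close>
  have "Q x p q = x powr q * (x - 1 + p * (?u - 1))"
    using e assms by (simp add: Q_def powr_add algebra_simps)
  then have "Q x p q = 0 \<longleftrightarrow> x - 1 + p * (?u - 1) = 0"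
    using e by simp
  also have "\<dots> \<longleftrightarrow> Phi x q = p"
    using u assms by (auto simp: Phi_def field_simps)
  finally show ?thesis .
qed

text \<open>The derivative of \<open>Q\<close> at its zero 1 is \<open>1 - p * q\<close>. Its sign
  tells on which side of 1 the function dips below 0, and the intermediate value theorem finds the
  second zero on that side.\<close>

lemma Phi_surj:
  assumes "p > 0" "q > 0"
  obtains x where "x > 0" "Phi x q = p"
proof -
  have d: "((\<lambda>x. Q x p q) has_real_derivative (1 - p * q)) (at 1)"
    unfolding Q_def by (auto intro!: derivative_eq_intros simp: algebra_simps)
  have Q1: "Q 1 p q = 0" by (simp add: Q_def)
  have cont: "continuous_on S (\<lambda>x. Q x p q)" if "S \<subseteq> {0..}" for S
    unfolding Q_def using that assms by (intro continuous_intros continuous_on_powr') auto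
  consider "p * q = 1" | "p * q < 1" | "p * q > 1" by linarith
  then show thesis
  proof cases
    case 1
    then show thesis using that[of 1] assms by (simp add: Phi_def field_simps)
  next
    case 2
    then obtain e where e: "e > 0" "\<And>h. h > 0 \<Longrightarrow> h < e \<Longrightarrow> Q (1 - h) p q < 0"
      using DERIV_pos_inc_left[OF d] Q1 by auto
    \<comment> \<open>The bound \<open>1/2\<close> keeps \<open>c\<close> positive. At the left end
      \<open>0 powr q = 0\<close>, so \<open>Q 0 p q = p > 0\<close>.\<close>
    define c where "c = 1 - min (e/2) (1/2)"
    have c: "0 < c" "c < 1" "Q c p q < 0" using e by (auto simp: c_def)
    have "\<exists>x\<ge>0. x \<le> c \<and> Q x p q = 0"
      using c assms by (intro IVT2' cont) (auto simp: Q_def)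
    then obtain x where x: "0 \<le> x" "x \<le> c" "Q x p q = 0" by blast
    moreover have "x \<noteq> 0" using x assms by (auto simp: Q_def)
    ultimately show thesis using that[of x] Q_eq_0_iff[of x q p] c assms by auto
  next
    case 3
    then obtain e where e: "e > 0" "\<And>h. h > 0 \<Longrightarrow> h < e \<Longrightarrow> Q (1 + h) p q < 0"
      using DERIV_neg_dec_right[OF d] Q1 by auto
    \<comment> \<open>The bound \<open>p/2\<close> keeps \<open>c\<close> below
      \<open>p + 1\<close>, where the first two terms of \<open>Q\<close> cancel and its value is
      \<open>p > 0\<close>.\<close>
    define c where "c = 1 + min (e/2) (p/2)"
    have c: "1 < c" "c < p + 1" "Q c p q < 0" using e assms by (auto simp: c_def)
    have "\<exists>x\<ge>c. x \<le> p + 1 \<and> Q x p q = 0"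
      using c assms by (intro IVT' cont) (auto simp: Q_def powr_add)
    then obtain x where x: "c \<le> x" "x \<le> p + 1" "Q x p q = 0" by blast
    then show thesis using that[of x] Q_eq_0_iff[of x q p] c assms by auto
  qed
qed

text \<open>Injectivity of \<open>Phi\<close> in \<open>x\<close> makes the definite description in
  \<open>lam\<close> well defined. The case \<open>x = 1\<close> is exactly the branch
  \<open>p * q = 1\<close>.\<close>

lemma lam_Phi: "lam (Phi x q) q = x" if "x > 0" "q > 0"
proof (cases "x = 1")
  case True
  then show ?thesis using that by (simp add: lam_def Phi_def)
next
  case False
  have inj: "y = x" if "y > 0" "Phi y q = Phi x q" for y
    using that \<open>x > 0\<close> \<open>q > 0\<close> Phi_strict_mono[of x y q] Phi_strict_mono[of y x q]
    by (cases x y rule: linorder_cases) auto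
  have "Phi x q * q \<noteq> 1"
    using inj[of 1] False that by (auto simp: Phi_def[of 1] field_simps)
  moreover have "(THE y. y > 0 \<and> y \<noteq> 1 \<and> Q y (Phi x q) q = 0) = x"
    using Q_eq_0_iff[of _ q "Phi x q"] inj that False by (intro the_equality) auto
  ultimately show ?thesis by (simp add: lam_def)
qed

lemma
  assumes "p > 0" "q > 0"
  shows lam_pos: "lam p q > 0" and Phi_lam: "Phi (lam p q) q = p"
  using Phi_surj[OF assms] lam_Phi assms by metis+

lemma
  assumes "p > 0" "q > 0" "x > 0"
  shows less_lam_iff: "x < lam p q \<longleftrightarrow> Phi x q < p"
    and lam_less_iff: "lam p q < x \<longleftrightarrow> p < Phi x q"
    and lam_eq_iff: "lam p q = x \<longleftrightarrow> Phi x q = p"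
  using Phi_strict_mono[of x "lam p q" q] Phi_strict_mono[of "lam p q" x q]
    Phi_lam[OF assms(1,2)] lam_pos[OF assms(1,2)] assms
  by (cases x "lam p q" rule: linorder_cases; force)+

lemma lam_eq_one_iff: "lam p q = 1 \<longleftrightarrow> p * q = 1" if "p > 0" "q > 0"
  using lam_eq_iff[OF that, of 1] that by (auto simp: Phi_def field_simps)

section \<open>Monotonicity of \<open>lam\<close> in both arguments\<close>

lemma Phi_strict_antimono: "Phi x r < Phi x q" if "x > 0" "0 < q" "q < r"
proof (cases x "1 :: real" rule: linorder_cases)
  case less
  then have "1 < exp (- (q * ln x))" "exp (- (q * ln x)) < exp (- (r * ln x))"
    using that exp_mult_ln_gt_one[of x q] by auto
  then show ?thesis using less by (simp add: Phi_def divide_strict_left_mono)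
next
  case equal
  then show ?thesis using that by (simp add: Phi_def field_simps)
next
  case greater
  then have "exp (- (q * ln x)) < 1" "exp (- (r * ln x)) < 1"
    "exp (- (r * ln x)) < exp (- (q * ln x))"
    using that exp_mult_ln_less_one[of x q] exp_mult_ln_less_one[of x r] by auto
  \<comment> \<open>For \<open>x > 1\<close> numerator and denominator of \<open>Phi\<close> are
    negative; both are negated so that the comparison of fractions has a positive numerator.\<close>
  then have "(x - 1) / (1 - exp (- (r * ln x))) < (x - 1) / (1 - exp (- (q * ln x)))"
    using greater by (intro divide_strict_left_mono mult_pos_pos) auto
  then show ?thesis
    using greater minus_divide_divide[of "x - 1" "1 - exp (- (_ * ln x))"] by (simp add: Phi_def)
qed

lemma lam_strict_mono_left: "lam p q < lam p' q" if "0 < p" "p < p'" "q > 0"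
  using that lam_less_iff[of p q "lam p' q"] Phi_lam[of p' q] lam_pos[of p' q] by simp

lemma lam_strict_mono_right: "lam p q < lam p q'" if "p > 0" "0 < q" "q < q'"
  using that less_lam_iff[of p q' "lam p q"] Phi_lam[of p q] lam_pos[of p q]
    Phi_strict_antimono[of "lam p q" q q'] by simp

lemma lam_strict_mono:
  assumes "0 < p" "0 < q" "p \<le> p'" "q \<le> q'" "(p, q) \<noteq> (p', q')"
  shows "lam p q < lam p' q'"
proof -
  consider "p < p'" "q = q'" | "p = p'" "q < q'" | "p < p'" "q < q'"
    using assms by force
  then show ?thesis
  proof cases
    case 3
    then have "lam p q < lam p' q" using assms lam_strict_mono_left by simp
    also have "\<dots> < lam p' q'" using assms 3 lam_strict_mono_right by simp
    finally show ?thesis .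
  qed (use assms lam_strict_mono_left lam_strict_mono_right in auto)
qed

section \<open>Continuity of \<open>lam\<close>\<close>

lemma isCont_Phi: "isCont (Phi x) q" if "x > 0" "q > 0"
proof (cases "x = 1")
  case True
  then show ?thesis using that by (auto simp: Phi_def[abs_def] intro!: continuous_intros)
next
  case False
  then show ?thesis using that exp_mult_ln_neq_one[of x q]
    by (auto simp: Phi_def[abs_def] intro!: continuous_intros)
qed

text \<open>For \<open>a > 0\<close> the bounds \<open>a < lam p q\<close> and
  \<open>lam p q < a\<close> become strict inequalities between \<open>Phi a q\<close> and
  \<open>p\<close>. Both sides are continuous in \<open>(p, q)\<close>, so the inequalities persist
  nearby. Lower bounds \<open>a \<le> 0\<close> follow from positivity.\<close>

lemma isCont_lam:
  assumes "p > 0" "q > 0"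
  shows "isCont (\<lambda>(p, q). lam p q) (p, q)"
proof -
  have ev: "\<forall>\<^sub>F z in at (p, q). 0 < fst z \<and> 0 < snd z"
  proof -
    have "open ({0<..} \<times> {0<..} :: (real \<times> real) set)" by (intro open_Times) auto
    from eventually_at_in_open'[OF this, of "(p, q)"] assms show ?thesis
      by (auto elim: eventually_mono)
  qed
  have Phi: "((\<lambda>z. Phi x (snd z)) \<longlongrightarrow> Phi x q) (at (p, q))" if "x > 0" for x
    using isCont_tendsto_compose[OF _ tendsto_snd[OF tendsto_ident_at[of "(p, q)"]], of "Phi x"]
      isCont_Phi[OF that \<open>q > 0\<close>] by simp
  have fst: "(fst \<longlongrightarrow> p) (at (p, q))"
    using tendsto_fst[OF tendsto_ident_at, of "(p, q)" UNIV] by simp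
  have "((\<lambda>z. lam (fst z) (snd z)) \<longlongrightarrow> lam p q) (at (p, q))"
  proof (rule order_tendstoI)
    fix a assume a: "a < lam p q"
    show "\<forall>\<^sub>F z in at (p, q). a < lam (fst z) (snd z)"
    proof (cases "a > 0")
      case True
      then have "\<forall>\<^sub>F z in at (p, q). Phi a (snd z) < fst z"
        using a assms less_lam_iff by (intro eventually_less_tendsto[OF Phi fst]) auto
      with ev show ?thesis
        by eventually_elim (use True less_lam_iff in auto)
    next
      case False
      from ev show ?thesis
        by eventually_elim (use False in \<open>auto intro!: le_less_trans[of a 0] lam_pos\<close>)
    qed
  next
    fix a assume a: "lam p q < a"
    then have "a > 0" using lam_pos[OF assms] by simp
    then have "\<forall>\<^sub>F z in at (p, q). fst z < Phi a (snd z)"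
      using a assms lam_less_iff by (intro eventually_less_tendsto[OF fst Phi]) auto
    with ev show "\<forall>\<^sub>F z in at (p, q). lam (fst z) (snd z) < a"
      by eventually_elim (use \<open>a > 0\<close> lam_less_iff in auto)
  qed
  then show ?thesis by (simp add: isCont_def case_prod_unfold)
qed

subsection \<open>Limits\<close>

text \<open>For \<open>0 < e < 1\<close> the bound \<open>lam p q < e\<close> amounts to
  \<open>p * (exp (- (q * ln e)) - 1) < 1 - e\<close>. The left side is continuous up to the axes
  and vanishes there, at the corner too.\<close>

lemma tendsto_lam_boundary:
  assumes "p0 \<ge> 0" "q0 \<ge> 0" "p0 = 0 \<or> q0 = 0"
  shows "((\<lambda>(p, q). lam p q) \<longlongrightarrow> 0) (at (p0, q0) within {0<..} \<times> {0<..})"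
    (is "(_ \<longlongrightarrow> _) ?F")
proof (rule order_tendstoI)
  have ev: "\<forall>\<^sub>F z in ?F. 0 < fst z \<and> 0 < snd z"
    by (auto simp: eventually_at_filter intro: always_eventually)
  {
    fix a :: real assume "a < 0"
    from ev show "\<forall>\<^sub>F z in ?F. a < (case z of (p, q) \<Rightarrow> lam p q)"
      by eventually_elim (use \<open>a < 0\<close> in \<open>auto intro!: less_trans[of a 0] lam_pos\<close>)
  next
    fix a :: real assume "0 < a"
    \<comment> \<open>A value below 1 makes the denominator of \<open>Phi e\<close> positive, so
      that the fraction can be cleared.\<close>
    define e where "e = min a (1/2)"
    have e: "0 < e" "e < 1" "e \<le> a" using \<open>0 < a\<close> by (auto simp: e_def)
    have "((\<lambda>z. fst z * (exp (- (snd z * ln e)) - 1)) \<longlongrightarrow> p0 * (exp (- (q0 * ln e)) - 1)) ?F"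
      by (auto intro!: tendsto_eq_intros)
    moreover have "p0 * (exp (- (q0 * ln e)) - 1) < 1 - e"
      using assms e by auto
    ultimately have "\<forall>\<^sub>F z in ?F. fst z * (exp (- (snd z * ln e)) - 1) < 1 - e"
      by (rule order_tendstoD)
    with ev show "\<forall>\<^sub>F z in ?F. (case z of (p, q) \<Rightarrow> lam p q) < a"
    proof eventually_elim
      case (elim z)
      then have "fst z < Phi e (snd z)"
        using e exp_mult_ln_gt_one[of e "snd z"] by (simp add: Phi_def field_simps)
      then have "lam (fst z) (snd z) < e"
        using elim e lam_less_iff by blast
      then show ?case using e by (simp add: case_prod_unfold)
    qed
  }
qed

lemma lam_extension:
  "continuous_on ({0..} \<times> {0..}) (\<lambda>(p, q). if p > 0 \<and> q > 0 then lam p q else 0)"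
    (is "continuous_on ?C ?g")
  unfolding continuous_on_def
proof
  fix z :: "real \<times> real" assume "z \<in> ?C"
  then obtain p q where z: "z = (p, q)" "p \<ge> 0" "q \<ge> 0" by auto
  let ?O = "{0<..} \<times> {0<..} :: (real \<times> real) set"
  show "(?g \<longlongrightarrow> ?g z) (at z within ?C)"
  proof (cases "p > 0 \<and> q > 0")
    case True
    have "open ?O" by (intro open_Times) auto
    moreover have "isCont (\<lambda>(p, q). lam p q) z"
      using True isCont_lam z by simp
    ultimately have "isCont ?g z"
      using True z eventually_nhds_in_open[of ?O z]
      by (subst isCont_cong[of _ "\<lambda>(p, q). lam p q"]) (auto elim!: eventually_mono)
    then show ?thesis
      using continuous_at_imp_continuous_at_within continuous_within by blast
  next
    case False
    then have "((\<lambda>(p, q). lam p q) \<longlongrightarrow> 0) (at z within ?O)"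
      using z by (auto intro!: tendsto_lam_boundary)
    then have "(?g \<longlongrightarrow> 0) (at z within ?O)"
      by (rule Lim_transform_within[of _ _ _ _ 1]) auto
    \<comment> \<open>Off the open quadrant \<open>?g\<close> is identically 0; the two one-set
      limits are then combined.\<close>
    moreover have "(?g \<longlongrightarrow> 0) (at z within ?C - ?O)"
      by (rule Lim_transform_within[of "\<lambda>_. 0" _ _ _ 1]) (auto split: if_splits)
    ultimately have "(?g \<longlongrightarrow> 0) (at z within ?O \<union> (?C - ?O))"
      using Lim_within_Un by blast
    moreover have "?O \<union> (?C - ?O) = ?C" by force
    ultimately show ?thesis using False z by auto
  qed
qed

lemma lam_one_right: "lam p 1 = p" if "p > 0"
proof -
  have "Phi p 1 = p"
    using that by (simp add: Phi_def exp_minus field_simps)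
  then show ?thesis using lam_Phi[of p 1] that by simp
qed

lemma le_lam: "p \<le> lam p q" if "p > 0" "q \<ge> 1"
  using lam_strict_mono_right[of p 1 q] lam_one_right[of p] that by (cases "q = 1") auto

text \<open>\<open>Phi (p + 1) q\<close> is \<open>p\<close> divided by a number strictly between 0
  and 1, hence exceeds \<open>p\<close>.\<close>

lemma lam_less: "lam p q < p + 1" if "p > 0" "q > 0"
  using that lam_less_iff[of p q "p + 1"] exp_mult_ln_less_one[of "p + 1" q]
  by (simp add: Phi_def field_simps)

lemma tendsto_lam_at_top:
  assumes "p > 0"
  shows "(lam p \<longlongrightarrow> p + 1) at_top"
proof (rule order_tendstoI)
  fix a assume "a < p + 1"
  \<comment> \<open>The maximum ensures \<open>x > 1\<close>, so \<open>exp (- (q * ln x))\<close>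
    tends to 0 and \<open>Phi x q\<close> to \<open>x - 1 < p\<close>.\<close>
  define x where "x = max a (1 + p / 2)"
  have x: "1 < x" "x < p + 1" "a \<le> x" using \<open>a < p + 1\<close> assms by (auto simp: x_def)
  have "((\<lambda>q. p * (1 - exp (- (q * ln x)))) \<longlongrightarrow> p * (1 - 0)) at_top"
    using x by (intro tendsto_intros filterlim_compose[OF exp_at_bot]
      filterlim_compose[OF filterlim_uminus_at_bot_at_top]
      filterlim_at_top_mult_tendsto_pos[OF tendsto_const] filterlim_ident) auto
  then have "\<forall>\<^sub>F q in at_top. x - 1 < p * (1 - exp (- (q * ln x)))"
    using x by (intro order_tendstoD) auto
  with eventually_gt_at_top[of 0] show "\<forall>\<^sub>F q in at_top. a < lam p q"
  proof eventually_elim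
    case (elim q)
    then have "Phi x q < p"
      using x exp_mult_ln_less_one[of x q] by (simp add: Phi_def field_simps)
    then have "x < lam p q" using less_lam_iff[of p q x] elim assms x by simp
    then show ?case using x by simp
  qed
next
  fix a assume "p + 1 < a"
  from eventually_gt_at_top[of 0] show "\<forall>\<^sub>F q in at_top. lam p q < a"
    by eventually_elim (use \<open>p + 1 < a\<close> lam_less[OF assms] in \<open>auto intro: less_trans\<close>)
qed

section \<open>Monotonicity along lines\<close>

lemma strict_mono_on_lam_line:
  assumes "0 \<le> \<alpha>" "\<alpha> \<le> pi / 2"
  shows "strict_mono_on {t. a + t * cos \<alpha> > 0 \<and> b + t * sin \<alpha> > 0}
           (\<lambda>t. lam (a + t * cos \<alpha>) (b + t * sin \<alpha>))"
proof (rule strict_mono_onI)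
  fix s t assume st: "s < t" "s \<in> {t. a + t * cos \<alpha> > 0 \<and> b + t * sin \<alpha> > 0}"
  \<comment> \<open>A direction in the closed first quadrant moves neither coordinate backwards and
    at least one forwards.\<close>
  have "cos \<alpha> \<ge> 0" "sin \<alpha> \<ge> 0"
    using assms by (auto intro!: cos_ge_zero sin_ge_zero)
  moreover have "cos \<alpha> \<noteq> 0 \<or> sin \<alpha> \<noteq> 0"
    using sin_zero_abs_cos_one by fastforce
  ultimately show "lam (a + s * cos \<alpha>) (b + s * sin \<alpha>) < lam (a + t * cos \<alpha>) (b + t * sin \<alpha>)"
    using st by (intro lam_strict_mono) (auto intro!: mult_right_mono)
qed

subsection \<open>Integer exponents\<close>

text \<open>Geometric summation cancels the factor \<open>1 - s\<close>; at \<open>s = 1\<close>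
  both sides are \<open>1 / n\<close>.\<close>

lemma Phi_of_nat:
  assumes "s > 0" "n \<ge> 1"
  shows "Phi s (real n) = s ^ n / (\<Sum>k<n. s ^ k)"
proof (cases "s = 1")
  case True
  then show ?thesis by (simp add: Phi_def)
next
  case False
  have "exp (- (real n * ln s)) = 1 / s ^ n"
    using assms by (simp add: exp_minus exp_of_nat_mult inverse_eq_divide)
  moreover have "(1 - s) * (\<Sum>k<n. s ^ k) = 1 - s ^ n"
    by (simp add: one_diff_power_eq)
  moreover have "(\<Sum>k<n. s ^ k) > 0"
    using assms by (intro sum_pos) (auto simp: lessThan_empty_iff)
  moreover have "exp (- (real n * ln s)) \<noteq> 1"
    using exp_mult_ln_neq_one[of s n] assms False by simp
  ultimately show ?thesis
    using False assms by (simp add: Phi_def field_simps)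
qed

lemma poly_P: "poly (P n p) s = s ^ n - p * (\<Sum>k<n. s ^ k)"
  by (simp add: P_def poly_monom poly_sum)

lemma map_poly_P:
  "map_poly complex_of_real (P n p) = monom 1 n - smult (of_real p) (\<Sum>k<n. monom 1 k)"
  by (rule poly_eqI) (auto simp: P_def coeff_map_poly coeff_sum)

lemma poly_map_P:
  "poly (map_poly complex_of_real (P n p)) w = w ^ n - of_real p * (\<Sum>k<n. w ^ k)"
  by (simp add: map_poly_P poly_monom poly_sum)

text \<open>Division by the positive sum gives \<open>poly (P n p) s\<close> the sign of
  \<open>Phi s n - p\<close>.\<close>

lemma
  assumes "s > 0" "n \<ge> 1" "p > 0"
  shows poly_P_eq_0_iff: "poly (P n p) s = 0 \<longleftrightarrow> lam p (real n) = s"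
    and poly_P_nonpos_iff: "poly (P n p) s \<le> 0 \<longleftrightarrow> s \<le> lam p (real n)"
proof -
  have pos: "(\<Sum>k<n. s ^ k) > 0"
    using assms by (intro sum_pos) (auto simp: lessThan_empty_iff)
  have "poly (P n p) s = 0 \<longleftrightarrow> Phi s (real n) = p"
    using pos Phi_of_nat assms by (simp add: poly_P field_simps)
  then show "poly (P n p) s = 0 \<longleftrightarrow> lam p (real n) = s"
    using lam_eq_iff assms by simp
  have "poly (P n p) s \<le> 0 \<longleftrightarrow> Phi s (real n) \<le> p"
    using pos Phi_of_nat assms by (simp add: poly_P field_simps)
  then show "poly (P n p) s \<le> 0 \<longleftrightarrow> s \<le> lam p (real n)"
    using lam_less_iff[of p "real n" s] assms by (auto simp: not_less[symmetric])
qed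

lemma poly_P_lam: "poly (P n p) (lam p n) = 0" if "p > 0" "n \<ge> 1"
  using that poly_P_eq_0_iff[of "lam p n" n p] by (simp add: lam_pos)

lemma poly_map_P_lam:
  "poly (map_poly complex_of_real (P n p)) (of_real (lam p n)) = 0" if "p > 0" "n \<ge> 1"
proof -
  have "poly (map_poly complex_of_real (P n p)) (of_real (lam p n))
      = of_real (poly (P n p) (lam p n))"
    by (simp add: poly_map_P poly_P)
  then show ?thesis using poly_P_lam[OF that] by simp
qed

text \<open>The root \<open>r\<close> is simple because \<open>r\<close> times the derivative at
  \<open>r\<close> is positive: substituting the root equation for \<open>r ^ n\<close> turns it
  into \<open>p * (\<Sum>k<n. (n - k) * r ^ k)\<close>.\<close>

lemma order_P_lam:
  assumes "p > 0" "n \<ge> 1"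
  shows "order (complex_of_real (lam p n)) (map_poly complex_of_real (P n p)) = 1"
proof -
  define r where "r = lam p n"
  let ?P = "map_poly complex_of_real (P n p)"
  have r: "r > 0" using assms by (simp add: r_def lam_pos)
  have root: "poly (P n p) r = 0" using poly_P_lam assms by (simp add: r_def)
  have root': "poly ?P (of_real r) = 0" using poly_map_P_lam assms by (simp add: r_def)
  have coeff: "coeff ?P n = 1" by (simp add: map_poly_P coeff_sum)
  then have "?P \<noteq> 0" by auto
  \<comment> \<open>The extra factor \<open>r\<close> removes the truncated exponent
    \<open>k - 1\<close>; for \<open>k = 0\<close> both sides vanish.\<close>
  have mult_pderiv: "r * (real k * r ^ (k - 1)) = real k * r ^ k" for k
    by (cases k) auto
  have "of_real r * poly (pderiv ?P) (of_real r)
      = complex_of_real (r * (real n * r ^ (n - 1) - p * (\<Sum>k<n. real k * r ^ (k - 1))))"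
    by (simp add: map_poly_P pderiv_diff pderiv_smult higher_pderiv_sum[of 1, simplified]
      pderiv_monom poly_monom poly_sum)
  also have "r * (real n * r ^ (n - 1) - p * (\<Sum>k<n. real k * r ^ (k - 1)))
      = real n * r ^ n - p * (\<Sum>k<n. real k * r ^ k)"
    by (simp only: right_diff_distrib mult.left_commute[of r p] sum_distrib_left[of r] mult_pderiv)
  finally have eq: "of_real r * poly (pderiv ?P) (of_real r)
      = complex_of_real (real n * r ^ n - p * (\<Sum>k<n. real k * r ^ k))" .
  have "real n * r ^ n = p * (\<Sum>k<n. real n * r ^ k)"
    using root by (simp add: poly_P flip: sum_distrib_left)
  then have "real n * r ^ n - p * (\<Sum>k<n. real k * r ^ k)
      = p * (\<Sum>k<n. (real n - real k) * r ^ k)"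
    by (simp add: sum_subtractf algebra_simps)
  also have "\<dots> > 0"
    using assms r by (intro mult_pos_pos sum_pos) (auto simp: lessThan_empty_iff)
  finally have "poly (pderiv ?P) (of_real r) \<noteq> 0"
    using eq by (metis less_irrefl mult_zero_right of_real_eq_0_iff)
  then have "order (of_real r) (pderiv ?P) = 0"
    by (rule order_0I)
  then show ?thesis
    using order_pderiv[OF \<open>?P \<noteq> 0\<close> root'] by (simp add: r_def)
qed

text \<open>The triangle inequality applied to the root equation of \<open>w\<close> makes
  \<open>P n p\<close> nonpositive at \<open>cmod w\<close>, so \<open>cmod w \<le> r\<close>.
  Equality forces \<open>w\<close> onto the positive real axis.\<close>

lemma is_dominant_root_lam:
  assumes "p > 0" "n \<ge> 1"
  shows "is_dominant_root (map_poly complex_of_real (P n p)) (complex_of_real (lam p n))"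
proof -
  define r where "r = lam p n"
  let ?P = "map_poly complex_of_real (P n p)"
  have r: "r > 0" using assms by (simp add: r_def lam_pos)
  have root': "poly ?P (of_real r) = 0" using poly_map_P_lam assms by (simp add: r_def)
  \<comment> \<open>the equation \<open>(1 - w) * P w = 0\<close> rearranged; it turns \<open>cmod w = r\<close> into \<open>cmod (p + 1 - w) = p + 1 - r\<close>\<close>
  have multiple: "w ^ n * (of_real p + 1 - w) = of_real p" if "poly ?P w = 0" for w
  proof -
    have "0 = (1 - w) * (w ^ n - of_real p * (\<Sum>k<n. w ^ k))"
      using that by (simp add: poly_map_P)
    also have "\<dots> = (1 - w) * w ^ n - of_real p * ((1 - w) * (\<Sum>k<n. w ^ k))"
      by (simp add: algebra_simps)
    also have "(1 - w) * (\<Sum>k<n. w ^ k) = 1 - w ^ n"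
      by (simp add: one_diff_power_eq)
    finally show ?thesis by (simp add: algebra_simps)
  qed
  have r_eq: "r ^ n * (p + 1 - r) = p"
  proof -
    have "complex_of_real (r ^ n * (p + 1 - r)) = of_real p"
      using multiple[OF root'] by simp
    then show ?thesis by (simp only: of_real_eq_iff)
  qed
  have "cmod w < r" if w: "poly ?P w = 0" "w \<noteq> of_real r" for w
  proof (cases "w = 0")
    case False
    have "w ^ n = of_real p * (\<Sum>k<n. w ^ k)"
      using w by (simp add: poly_map_P)
    then have "cmod w ^ n = p * cmod (\<Sum>k<n. w ^ k)"
      using assms by (simp add: norm_mult flip: norm_power)
    also have "\<dots> \<le> p * (\<Sum>k<n. cmod w ^ k)"
      using assms by (intro mult_left_mono sum_norm_le) (auto simp: norm_power)
    finally have "cmod w \<le> r"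
      using poly_P_nonpos_iff[of "cmod w" n p] False assms by (simp add: poly_P r_def)
    moreover have "cmod w \<noteq> r"
    proof
      assume eq: "cmod w = r"
      have "r ^ n * cmod (of_real p + 1 - w) = cmod (w ^ n * (of_real p + 1 - w))"
        by (simp add: norm_mult norm_power eq)
      also have "\<dots> = r ^ n * (p + 1 - r)"
        using multiple[OF w(1)] assms r_eq by simp
      finally have "cmod (of_real p + 1 - w) = p + 1 - r"
        using r by simp
      \<comment> \<open>The real part of \<open>p + 1 - w\<close> is at most its modulus
        \<open>p + 1 - r\<close>. Together with \<open>cmod w = r\<close> this leaves no imaginary
        part.\<close>
      then have "Re w \<ge> r"
        using complex_Re_le_cmod[of "of_real p + 1 - w"] by simp
      moreover have "(Re w)\<^sup>2 + (Im w)\<^sup>2 = r\<^sup>2" "Re w \<le> r"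
        using eq cmod_power2[of w] complex_Re_le_cmod[of w] by auto
      ultimately have "w = of_real r"
        by (simp add: complex_eq_iff)
      with w show False by simp
    qed
    ultimately show ?thesis by simp
  qed (use r in simp)
  then show ?thesis
    using r root' order_P_lam[OF assms] by (auto simp: is_dominant_root_def r_def)
qed

lemma lam_of_nat: "lam p (real n) = lam_n n p" if "p > 0" "n \<ge> 1"
  unfolding lam_n_def
  by (rule sym, rule the_equality)
    (use that is_dominant_root_lam poly_P_eq_0_iff in \<open>auto simp: lam_pos\<close>)

subsection \<open>Smoothness\<close>

text \<open>On an open set, functions that agree have the same derivatives, so agreement passes down
  the recursion of \<open>C_on\<close>.\<close>

lemma C_on_cong:
  assumes "open S" "\<And>x. x \<in> S \<Longrightarrow> f x = g x" "C_on k S f"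
  shows "C_on k S g"
  using assms(2,3)
proof (induction k arbitrary: f g)
  case 0
  then show ?case using continuous_on_cong[of S S f g] by simp
next
  case (Suc k)
  have diff: "f differentiable (at x)" if "x \<in> S" for x
    using Suc.prems(2) that by simp
  have "g differentiable (at x)" if "x \<in> S" for x
    using diff[OF that] Suc.prems(1) that \<open>open S\<close>
    unfolding differentiable_def by (meson has_derivative_transform_within_open)
  moreover have "C_on k S (\<lambda>x. frechet_derivative g (at x) v)" for v
  proof (rule Suc.IH)
    show "C_on k S (\<lambda>x. frechet_derivative f (at x) v)"
      using Suc.prems(2) by simp
    show "frechet_derivative f (at x) v = frechet_derivative g (at x) v" if "x \<in> S" for x
      using frechet_derivative_transform_within_open[OF diff[OF that] \<open>open S\<close> that, of g]
        Suc.prems(1) by simp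
  qed
  ultimately show ?case by simp
qed

text \<open>If each member of \<open>A\<close> is differentiable on \<open>S\<close> with
  directional derivatives again in \<open>A\<close>, induction on \<open>k\<close> gives every
  order; level 0 holds as differentiability implies continuity.\<close>

lemma C_on_derivative_closed:
  assumes "open S"
    and closed: "\<And>f. f \<in> A \<Longrightarrow>
      \<exists>D. (\<forall>v. D v \<in> A) \<and> (\<forall>x\<in>S. (f has_derivative (\<lambda>v. D v x)) (at x))"
    and "f \<in> A"
  shows "C_on k S f"
  using \<open>f \<in> A\<close>
proof (induction k arbitrary: f)
  case 0
  then obtain D where "\<And>x. x \<in> S \<Longrightarrow> (f has_derivative (\<lambda>v. D v x)) (at x)"
    using closed by blast
  then show ?case
    by (auto intro!: continuous_at_imp_continuous_on dest: has_derivative_continuous)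
next
  case (Suc k)
  obtain D where D: "\<And>v. D v \<in> A" "\<And>x. x \<in> S \<Longrightarrow> (f has_derivative (\<lambda>v. D v x)) (at x)"
    using closed[OF Suc.prems] by blast
  have "f differentiable (at x)" if "x \<in> S" for x
    using D(2)[OF that] by (auto simp: differentiable_def)
  moreover have "C_on k S (\<lambda>x. frechet_derivative f (at x) v)" for v
    using \<open>open S\<close> _ Suc.IH[OF D(1)]
    by (rule C_on_cong) (simp flip: frechet_derivative_at[OF D(2)])
  ultimately show ?case by simp
qed

definition smooth_domain :: "(real \<times> real) set" where
  "smooth_domain = {(p, q). p > 0 \<and> q > 0 \<and> p * q \<noteq> 1}"

lemma open_smooth_domain: "open smooth_domain"
  unfolding smooth_domain_def case_prod_unfold
  by (intro open_Collect_conj open_Collect_less open_Collect_neq continuous_intros)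

text \<open>Implicit differentiation of \<open>Phi x q = p\<close>: the derivative in direction
  \<open>v\<close> is \<open>fst v\<close> minus \<open>snd v\<close> times the
  \<open>q\<close>-derivative of \<open>Phi\<close>, divided by its \<open>x\<close>-derivative,
  with the common denominator \<open>(u - 1)\<^sup>2\<close> cleared.\<close>

definition lam_grad :: "real \<times> real \<Rightarrow> real \<times> real \<Rightarrow> real" where
  "lam_grad v z = (let x = lam (fst z) (snd z); q = snd z; u = exp (- (q * ln x)) in
     (fst v * (u - 1)\<^sup>2 - snd v * ((1 - x) * ln x * u)) / (1 - u + (1 - x) * q * u / x))"

text \<open>The map \<open>g\<close>, sending \<open>(p, q)\<close> to \<open>(lam p q, q)\<close>,
  is a continuous right inverse of \<open>f\<close>, whose triangular derivative is invertible
  because \<open>N \<noteq> 0\<close>. The rule for derivatives of inverses then applies.\<close>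

lemma has_derivative_lam:
  assumes "z \<in> smooth_domain"
  shows "((\<lambda>z. lam (fst z) (snd z)) has_derivative (\<lambda>v. lam_grad v z)) (at z)"
proof -
  obtain p q where z: "z = (p, q)" "p > 0" "q > 0" "p * q \<noteq> 1" using assms by (auto simp: smooth_domain_def)
  define x where "x = lam p q"
  define u where "u = exp (- (q * ln x))"
  define N where "N = 1 - u + (1 - x) * q * u / x"
  have x: "x > 0" "x \<noteq> 1"
    using z lam_pos lam_eq_one_iff by (auto simp: x_def)
  have u: "u \<noteq> 1" using exp_mult_ln_neq_one[of x q] x z by (simp add: u_def)
  have N: "N \<noteq> 0" using Phi_deriv_numerator_pos[of x q] x z by (simp add: u_def N_def)
  \<comment> \<open>Keeping \<open>q\<close> as second component gives a map of the plane to itself.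
    The quotient formula suffices because \<open>lam\<close> avoids 1 on
    \<open>smooth_domain\<close>.\<close>
  define f where "f = (\<lambda>w :: real \<times> real. ((1 - fst w) / (exp (- (snd w * ln (fst w))) - 1), snd w))"
  define f' where "f' = (\<lambda>h :: real \<times> real.
    (N / (u - 1)\<^sup>2 * fst h + (1 - x) * ln x * u / (u - 1)\<^sup>2 * snd h, snd h))"
  define g where "g = (\<lambda>w. (lam (fst w) (snd w), snd w))"
  define g' where "g' = (\<lambda>v :: real \<times> real.
    ((fst v * (u - 1)\<^sup>2 - snd v * ((1 - x) * ln x * u)) / N, snd v))"
  have "(g has_derivative g') (at z)"
  proof (rule has_derivative_inverse_basic[where f = f and f' = f'])
    have denom: "((\<lambda>w. exp (- (snd w * ln (fst w))) - 1) has_derivative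
        (\<lambda>h. - u * (snd h * ln x + q * fst h / x))) (at (x, q))"
      using x by (auto intro!: derivative_eq_intros simp: u_def fun_eq_iff field_simps)
    have num: "((\<lambda>w. 1 - fst w) has_derivative (\<lambda>h. - fst h)) (at (x, q))"
      by (auto intro!: derivative_eq_intros)
    have eq: "(- a * (u - 1) - (1 - x) * (- u * (b * ln x + q * a / x))) / ((u - 1) * (u - 1))
        = N / (u - 1)\<^sup>2 * a + (1 - x) * ln x * u / (u - 1)\<^sup>2 * b" for a b
    proof -
      have "- a * (u - 1) - (1 - x) * (- u * (b * ln x + q * a / x)) = N * a + (1 - x) * ln x * u * b"
        using x by (simp add: N_def field_simps)
      then show ?thesis
        by (simp add: add_divide_distrib power2_eq_square)
    qed
    have "exp (- (snd (x, q) * ln (fst (x, q)))) - 1 \<noteq> 0"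
      using u by (simp add: u_def)
    from has_derivative_divide'[OF num denom this]
    have "((\<lambda>w. (1 - fst w) / (exp (- (snd w * ln (fst w))) - 1)) has_derivative
        (\<lambda>h. N / (u - 1)\<^sup>2 * fst h + (1 - x) * ln x * u / (u - 1)\<^sup>2 * snd h)) (at (x, q))"
      by (simp only: fst_conv snd_conv u_def[symmetric] eq)
    then show "(f has_derivative f') (at (g z))"
      unfolding f_def f'_def g_def z fst_conv snd_conv x_def[symmetric]
      by (intro has_derivative_Pair has_derivative_snd has_derivative_ident)
    show "bounded_linear g'"
      unfolding g'_def
      by (intro bounded_linear_Pair bounded_linear_compose[OF bounded_linear_divide]
        bounded_linear_sub bounded_linear_snd
        bounded_linear_const_mult bounded_linear_mult_const bounded_linear_fst)
    show "g' \<circ> f' = id"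
      using N u by (auto simp: fun_eq_iff g'_def f'_def field_simps)
    show "continuous (at z) g"
      unfolding g_def using isCont_lam[of p q] z
      by (intro continuous_Pair continuous_snd continuous_ident) (simp add: case_prod_unfold)
    show "f (g w) = w" if "w \<in> smooth_domain" for w
      using that lam_eq_one_iff[of "fst w" "snd w"] Phi_lam[of "fst w" "snd w"]
      by (auto simp: smooth_domain_def f_def g_def Phi_def split: if_splits)
  qed (use assms open_smooth_domain in auto)
  from has_derivative_fst[OF this] show ?thesis
    by (simp add: g_def g'_def lam_grad_def z Let_def flip: x_def u_def N_def)
qed

text \<open>Elementary expressions in \<open>p\<close>, \<open>q\<close> and \<open>lam\<close>,
  represented as functions. The side conditions on \<open>inverse\<close> and \<open>ln\<close> make
  every member differentiable on \<open>smooth_domain\<close>.\<close>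

inductive_set lam_alg :: "(real \<times> real \<Rightarrow> real) set" where
  const: "(\<lambda>_. c) \<in> lam_alg"
| fst: "fst \<in> lam_alg"
| snd: "snd \<in> lam_alg"
| lam: "(\<lambda>z. lam (fst z) (snd z)) \<in> lam_alg"
| add: "f \<in> lam_alg \<Longrightarrow> g \<in> lam_alg \<Longrightarrow> (\<lambda>z. f z + g z) \<in> lam_alg"
| mult: "f \<in> lam_alg \<Longrightarrow> g \<in> lam_alg \<Longrightarrow> (\<lambda>z. f z * g z) \<in> lam_alg"
| inverse: "f \<in> lam_alg \<Longrightarrow> (\<And>z. z \<in> smooth_domain \<Longrightarrow> f z \<noteq> 0) \<Longrightarrow> (\<lambda>z. inverse (f z)) \<in> lam_alg"
| exp: "f \<in> lam_alg \<Longrightarrow> (\<lambda>z. exp (f z)) \<in> lam_alg"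
| ln: "f \<in> lam_alg \<Longrightarrow> (\<And>z. z \<in> smooth_domain \<Longrightarrow> f z > 0) \<Longrightarrow> (\<lambda>z. ln (f z)) \<in> lam_alg"

lemma lam_alg_uminus: "f \<in> lam_alg \<Longrightarrow> (\<lambda>z. - f z) \<in> lam_alg"
  using lam_alg.mult[OF lam_alg.const[of "-1"]] by simp

lemma lam_alg_diff: "f \<in> lam_alg \<Longrightarrow> g \<in> lam_alg \<Longrightarrow> (\<lambda>z. f z - g z) \<in> lam_alg"
  using lam_alg.add[OF _ lam_alg_uminus] by simp

lemma lam_grad_in_lam_alg: "lam_grad v \<in> lam_alg"
proof -
  let ?x = "\<lambda>z. lam (fst z) (snd z)"
  let ?u = "\<lambda>z. exp (- (snd z * ln (?x z)))"
  have x: "?x z > 0" "?x z \<noteq> 0" if "z \<in> smooth_domain" for z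
    using that lam_pos[of "fst z" "snd z"] by (auto simp: smooth_domain_def)
  have N: "1 - ?u z + (1 - ?x z) * snd z * ?u z * inverse (?x z) \<noteq> 0" if "z \<in> smooth_domain" for z
    using that x[OF that] lam_eq_one_iff[of "fst z" "snd z"]
      Phi_deriv_numerator_pos[of "?x z" "snd z"] by (auto simp: smooth_domain_def divide_inverse)
  \<comment> \<open>The formula of \<open>lam_grad\<close> with its square and divisions spelled as
    products and \<open>inverse\<close>, to match the closure rules.\<close>
  have "(\<lambda>z. (fst v * ((?u z - 1) * (?u z - 1)) - snd v * ((1 - ?x z) * ln (?x z) * ?u z))
      * inverse (1 - ?u z + (1 - ?x z) * snd z * ?u z * inverse (?x z))) \<in> lam_alg"
    by (intro lam_alg.intros lam_alg_diff lam_alg_uminus x N; assumption)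
  then show ?thesis
    by (simp add: lam_grad_def[abs_def] Let_def power2_eq_square divide_inverse)
qed

text \<open>Rule induction: each differentiation rule uses only operations of the class, and the
  generator \<open>lam\<close> contributes \<open>lam_grad\<close>.\<close>

lemma lam_alg_derivative_closed:
  assumes "f \<in> lam_alg"
  shows "\<exists>D. (\<forall>v. D v \<in> lam_alg) \<and> (\<forall>z\<in>smooth_domain. (f has_derivative (\<lambda>v. D v z)) (at z))"
  using assms
proof induction
  case (const c)
  show ?case by (intro exI[of _ "\<lambda>_ _. 0"]) (auto intro: lam_alg.const)
next
  case fst
  show ?case
    by (intro exI[of _ "\<lambda>v _. fst v"]) (auto intro!: lam_alg.const derivative_eq_intros)
next
  case snd
  show ?case
    by (intro exI[of _ "\<lambda>v _. snd v"]) (auto intro!: lam_alg.const derivative_eq_intros)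
next
  case lam
  show ?case
    by (intro exI[of _ lam_grad]) (auto intro: lam_grad_in_lam_alg has_derivative_lam)
next
  case (add f g)
  obtain D where D: "\<And>v. D v \<in> lam_alg"
    "\<And>z. z \<in> smooth_domain \<Longrightarrow> (f has_derivative (\<lambda>v. D v z)) (at z)"
    using add.IH(1) by blast
  obtain E where E: "\<And>v. E v \<in> lam_alg"
    "\<And>z. z \<in> smooth_domain \<Longrightarrow> (g has_derivative (\<lambda>v. E v z)) (at z)"
    using add.IH(2) by blast
  show ?case
    by (intro exI[of _ "\<lambda>v z. D v z + E v z"] conjI allI ballI
      lam_alg.add has_derivative_add D E; assumption)
next
  case (mult f g)
  obtain D where D: "\<And>v. D v \<in> lam_alg"
    "\<And>z. z \<in> smooth_domain \<Longrightarrow> (f has_derivative (\<lambda>v. D v z)) (at z)"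
    using mult.IH(1) by blast
  obtain E where E: "\<And>v. E v \<in> lam_alg"
    "\<And>z. z \<in> smooth_domain \<Longrightarrow> (g has_derivative (\<lambda>v. E v z)) (at z)"
    using mult.IH(2) by blast
  show ?case
    by (intro exI[of _ "\<lambda>v z. f z * E v z + D v z * g z"] conjI allI ballI
      lam_alg.add lam_alg.mult mult.hyps has_derivative_mult D E; assumption)
next
  case (inverse f)
  obtain D where D: "\<And>v. D v \<in> lam_alg"
    "\<And>z. z \<in> smooth_domain \<Longrightarrow> (f has_derivative (\<lambda>v. D v z)) (at z)"
    using inverse.IH by blast
  show ?case
    by (intro exI[of _ "\<lambda>v z. - (inverse (f z) * D v z * inverse (f z))"] conjI allI ballI
      lam_alg_uminus lam_alg.mult lam_alg.inverse inverse.hyps Deriv.has_derivative_inverse D; assumption)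
next
  case (exp f)
  obtain D where D: "\<And>v. D v \<in> lam_alg"
    "\<And>z. z \<in> smooth_domain \<Longrightarrow> (f has_derivative (\<lambda>v. D v z)) (at z)"
    using exp.IH by blast
  show ?case
    by (intro exI[of _ "\<lambda>v z. D v z * exp (f z)"] conjI allI ballI
      lam_alg.mult lam_alg.exp exp.hyps has_derivative_exp D; assumption)
next
  case (ln f)
  obtain D where D: "\<And>v. D v \<in> lam_alg"
    "\<And>z. z \<in> smooth_domain \<Longrightarrow> (f has_derivative (\<lambda>v. D v z)) (at z)"
    using ln.IH by blast
  have inv: "(\<lambda>z. inverse (f z)) \<in> lam_alg"
    using ln.hyps by (intro lam_alg.inverse) force+
  show ?case
    by (intro exI[of _ "\<lambda>v z. D v z * inverse (f z)"] conjI allI ballI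
      lam_alg.mult inv ln.hyps has_derivative_ln D; assumption)
qed

lemma smooth_on_lam: "smooth_on smooth_domain (\<lambda>(p, q). lam p q)"
  unfolding smooth_on_def case_prod_unfold
  using open_smooth_domain
    C_on_derivative_closed[OF open_smooth_domain lam_alg_derivative_closed lam_alg.lam]
  by blast

theorem proposition2p2:
  shows
    "((\<forall>p>0. \<forall>q>0. lam p q > 0) \<and>
      continuous_on ({0<..} \<times> {0<..}) (\<lambda>(p, q). lam p q) \<and>
      (\<forall>p>0. \<forall>n::nat. n \<ge> 1 \<longrightarrow> lam p (real n) = lam_n n p))
     \<and>
     (smooth_on {(p, q). p > 0 \<and> q > 0 \<and> p * q \<noteq> 1} (\<lambda>(p, q). lam p q) \<and>
      (\<forall>a b \<alpha>::real. 0 \<le> \<alpha> \<and> \<alpha> \<le> pi / 2 \<longrightarrow>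
         strict_mono_on {t. a + t * cos \<alpha> > 0 \<and> b + t * sin \<alpha> > 0}
           (\<lambda>t. lam (a + t * cos \<alpha>) (b + t * sin \<alpha>))))
     \<and>
     ((\<forall>p>0. \<forall>q\<ge>1. p \<le> lam p q) \<and>
      (\<forall>p>0. ((\<lambda>q. lam p q) \<longlongrightarrow> p + 1) at_top))
     \<and>
     ((\<forall>p0>0. ((\<lambda>(p, q). lam p q) \<longlongrightarrow> 0) (at (p0, 0) within {0<..} \<times> {0<..})) \<and>
      (\<forall>q0>0. ((\<lambda>(p, q). lam p q) \<longlongrightarrow> 0) (at (0, q0) within {0<..} \<times> {0<..})) \<and>
      (\<exists>g::real \<times> real \<Rightarrow> real. continuous_on ({0..} \<times> {0..}) g \<and>
         (\<forall>p>0. \<forall>q>0. g (p, q) = lam p q)))"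
proof (fold smooth_domain_def, intro conjI allI impI)
  show "continuous_on ({0<..} \<times> {0<..}) (\<lambda>(p, q). lam p q)"
    using isCont_lam by (intro continuous_at_imp_continuous_on) auto
  show "\<exists>g::real \<times> real \<Rightarrow> real. continuous_on ({0..} \<times> {0..}) g \<and>
      (\<forall>p>0. \<forall>q>0. g (p, q) = lam p q)"
    using lam_extension by (intro exI conjI) auto
qed (auto intro: lam_pos lam_of_nat smooth_on_lam strict_mono_on_lam_line le_lam
    tendsto_lam_at_top tendsto_lam_boundary)

end
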